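(* Let $H=(V,E)$ be a hypergraph all of whose edges are finite sets, such that for every finite subset $E_0\subseteq E$ the hypergraph $(V,E_0)$ is bipartite. Then $H$ is bipartite.
   Context: A hypergraph is a pair $H=(V,E)$ where $V$ is a set (possibly infinite) and $E$ is a set (possibly infinite) of non-empty subsets of $V$, called edges. A hypergraph $H=(V,E)$ is bipartite if there is $D\subseteq V$ such that both $D$ and $V\setminus D$ intersect every $e\in E$ with $|e|>1$. *)

theory Defs
  imports Main
begin

definition hypergraph :: "'a set \<Rightarrow> 'a set set \<Rightarrow> bool" where
  "hypergraph V E \<longleftrightarrow> (\<forall>e\<in>E. e \<subseteq> V \<and> e \<noteq> {})"

text \<open>Edges may be infinite, and \<^const>\<open>card\<close> is 0 on infinite sets; the first disjunct below
  makes the condition express that the cardinality of the edge exceeds 1 in that case too.\<close>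

definition bipartite :: "'a set \<Rightarrow> 'a set set \<Rightarrow> bool" where
  "bipartite V E \<longleftrightarrow>
    (\<exists>D\<subseteq>V. \<forall>e\<in>E. infinite e \<or> card e > 1 \<longrightarrow> D \<inter> e \<noteq> {} \<and> (V - D) \<inter> e \<noteq> {})"

end

theory Submission
  imports Defs "HOL-Analysis.Function_Topology"
begin

text \<open>Two-colourings of the vertices form a power of the two-point discrete space, which is compact
  by Tychonoff's theorem. For a finite edge, being properly coloured depends on finitely many
  coordinates only and is therefore a closed condition. Bipartiteness of the finite subhypergraphs is
  the finite intersection property for these closed sets.\<close>

lemma closedin_bichromatic:
  assumes "finite e" "e \<subseteq> V"
  shows "closedin (product_topology (\<lambda>_. discrete_topology (UNIV :: bool set)) V)
           {f \<in> V \<rightarrow>\<^sub>E UNIV. (\<exists>x\<in>e. f x) \<and> (\<exists>y\<in>e. \<not> f y)}"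
    (is "closedin ?X _")
proof -
  have coord: "closedin ?X {f \<in> V \<rightarrow>\<^sub>E UNIV. f x = b}" if "x \<in> e" for x b
  proof -
    have "continuous_map ?X (discrete_topology UNIV) (\<lambda>f. f x)"
      using that assms by (intro continuous_map_product_projection) auto
    from closedin_continuous_map_preimage[OF this, of "{b}"] show ?thesis
      by simp
  qed
  \<comment> \<open>Finiteness of \<open>e\<close> enters here: a union of closed sets need not be
    closed unless it is finite.\<close>
  have ex: "closedin ?X (\<Union>x\<in>e. {f \<in> V \<rightarrow>\<^sub>E UNIV. f x = b})" for b
    using assms coord by (intro closedin_Union) auto
  have "{f \<in> V \<rightarrow>\<^sub>E UNIV. (\<exists>x\<in>e. f x) \<and> (\<exists>y\<in>e. \<not> f y)} =
      (\<Union>x\<in>e. {f \<in> V \<rightarrow>\<^sub>E UNIV. f x = True}) \<inter> (\<Union>x\<in>e. {f \<in> V \<rightarrow>\<^sub>E UNIV. f x = False})"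
    by auto
  then show ?thesis
    using ex by (simp only: closedin_Int)
qed

theorem proposition3p4:
  fixes V :: "'a set" and E :: "'a set set"
  assumes "hypergraph V E"
    and "\<forall>e\<in>E. finite e"
    and "\<forall>E0\<subseteq>E. finite E0 \<longrightarrow> bipartite V E0"
  shows "bipartite V E"
proof -
  define X where "X = product_topology (\<lambda>_. discrete_topology (UNIV :: bool set)) V"
  define C where "C e = {f \<in> V \<rightarrow>\<^sub>E UNIV. (\<exists>x\<in>e. f x) \<and> (\<exists>y\<in>e. \<not> f y)}" for e :: "'a set"
  \<comment> \<open>For a one-vertex edge \<open>C e\<close> is empty, so such edges must stay out
    of the family. Since all edges are finite, \<open>card e > 1\<close> singles out exactly the
    edges that bipartiteness constrains.\<close>
  define B where "B = {e \<in> E. card e > 1}"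
  have edge: "e \<subseteq> V" "finite e" if "e \<in> E" for e
    using that assms(1,2) by (auto simp: hypergraph_def)
  have "compact_space X"
    by (simp add: X_def compact_space_product_topology compact_space_discrete_topology)
  moreover have "\<forall>c\<in>C ` B. closedin X c"
    using closedin_bichromatic[OF edge(2,1)] by (auto simp: X_def C_def B_def)
  moreover have "\<Inter> \<F> \<noteq> {}" if "finite \<F>" "\<F> \<subseteq> C ` B" for \<F>
  proof -
    from that obtain E0 where E0: "E0 \<subseteq> B" "finite E0" "\<F> = C ` E0"
      by (meson finite_subset_image)
    then have "bipartite V E0"
      using assms(3) by (auto simp: B_def)
    then obtain D where D: "D \<subseteq> V"
        "\<And>e. e \<in> E0 \<Longrightarrow> D \<inter> e \<noteq> {} \<and> (V - D) \<inter> e \<noteq> {}"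
      using E0(1) unfolding bipartite_def B_def by blast
    \<comment> \<open>The indicator of \<open>D\<close> is a common point of the family; it is cut
      down to \<open>V\<close> because points of the product are extensional functions.\<close>
    have "restrict (\<lambda>x. x \<in> D) V \<in> C e" if "e \<in> E0" for e
      using D(1) D(2)[OF that] by (auto 0 4 simp: C_def)
    with E0(3) show ?thesis by blast
  qed
  ultimately have "\<Inter> (C ` B) \<noteq> {}"
    by (meson compact_space_fip)
  \<comment> \<open>If \<open>B\<close> is empty, the intersection is \<open>UNIV\<close> and
    \<open>f\<close> is arbitrary, which is harmless as no edge is then constrained.\<close>
  then obtain f where f: "\<And>e. e \<in> B \<Longrightarrow> f \<in> C e"
    by blast
  \<comment> \<open>The vertices coloured \<open>True\<close> serve as \<open>D\<close>; as
    \<open>e\<close> lies in \<open>V\<close>, its vertex coloured \<open>False\<close> lies in the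
    complement.\<close>
  have "{x \<in> V. f x} \<inter> e \<noteq> {} \<and> (V - {x \<in> V. f x}) \<inter> e \<noteq> {}"
    if "e \<in> E" "infinite e \<or> card e > 1" for e
    using f[of e] edge[of e] that by (auto simp: B_def C_def)
  then show ?thesis
    unfolding bipartite_def by (intro exI[of _ "{x \<in> V. f x}"]) auto
qed

end
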